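(* Let $q$ be a prime power and $n,d$ positive integers. Fix polynomials $h_1,\ldots,h_d\in\mathbb{F}_q[x_1,\ldots,x_n]$ of total degree at most $q-1$, and fix vectors $\mathbf{b}_i=(b_{i,1},\ldots,b_{i,n})\in(\mathbb{Z}^+)^n$, $1\le i\le d$, with $\gcd(b_{i,j},q-1)=1$ for all $i,j$. For $\mathbf{a}_i=(a_{i,1},\ldots,a_{i,n+1})\in\mathbb{F}_q^{n+1}$ put $f_{\mathbf{a}_i}(x_1,\ldots,x_n)=\sum_{j=1}^n a_{i,j}x_j^{b_{i,j}}+a_{i,n+1}$, and define the variety $$V_{\mathbf{a}_1,\ldots,\mathbf{a}_d}=\{(x_1,\ldots,x_{n+d})\in\mathbb{F}_q^{n+d}:\ x_{n+i}=h_i(x_1,\ldots,x_n)+f_{\mathbf{a}_i}(x_1,\ldots,x_n)\ \text{for all }1\le i\le d\}.$$ Let $\mathcal{P}$ be a set of points in $\mathbb{F}_q^{n+d}$ and $\mathcal{V}$ a set of varieties of the form $V_{\mathbf{a}_1,\ldots,\mathbf{a}_d}$. Then, if $d\ge 2$, $$\left|I(\mathcal{P},\mathcal{V})-\frac{|\mathcal{P}||\mathcal{V}|}{q^d}\right|\le q^{n/2}\sqrt{|\mathcal{P}||\mathcal{V}|}\left(1+\frac{|\mathcal{V}|}{q}\right)^{1/2},$$ and if $d=1$, $$\left|I(\mathcal{P},\mathcal{V})-\frac{|\mathcal{P}||\mathcal{V}|}{q}\right|\le q^{n/2}\left(1-\frac{1}{q}\right)\sqrt{|\mathcal{P}||\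mathcal{V}|}.$$
   Context: $I(\mathcal{P},\mathcal{V})$ denotes the number of pairs $(\mathbf{p},V)\in\mathcal{P}\times\mathcal{V}$ with $\mathbf{p}\in V$. *)

theory Defs
  imports "HOL-Analysis.Finite_Cartesian_Product" "HOL-Library.Poly_Mapping"
    "HOL-Library.Numeral_Type" Complex_Main
begin

text \<open>
  Polynomials in finitely many variables indexed by the type \<open>'n\<close>: finitely supported
  families of coefficients, indexed by exponent vectors.
\<close>

type_synonym ('n, 'a) mpoly = "('n \<Rightarrow>\<^sub>0 nat) \<Rightarrow>\<^sub>0 'a"

definition mpoly_eval :: "('n::finite, 'a::comm_semiring_1) mpoly \<Rightarrow> 'a ^ 'n \<Rightarrow> 'a" where
  "mpoly_eval p x =
     (\<Sum>m\<in>Poly_Mapping.keys p.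
        Poly_Mapping.lookup p m * (\<Prod>j\<in>UNIV. (x $ j) ^ Poly_Mapping.lookup m j))"

text \<open>The zero polynomial is given total degree 0.\<close>

definition total_degree :: "('n::finite, 'a::zero) mpoly \<Rightarrow> nat" where
  "total_degree p =
     Max (insert 0 ((\<lambda>m. \<Sum>j\<in>UNIV. Poly_Mapping.lookup m j) ` Poly_Mapping.keys p))"

text \<open>
  With \<open>n = CARD('n)\<close> and \<open>d = CARD('d)\<close>, the index types \<open>'n + 1\<close> and \<open>'n + 'd\<close> have
  \<open>n + 1\<close> and \<open>n + d\<close> elements. The coordinate \<open>Inl j\<close> plays the role of the index \<open>j \<le> n\<close>,
  \<open>Inr 1\<close> that of \<open>n + 1\<close>, and \<open>Inr i\<close> that of \<open>n + i\<close>.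
\<close>

definition diag_poly_fun ::
    "nat ^ 'n \<Rightarrow> 'a::comm_semiring_1 ^ ('n::finite + 1) \<Rightarrow> 'a ^ 'n \<Rightarrow> 'a" where
  "diag_poly_fun b a x = (\<Sum>j\<in>UNIV. a $ Inl j * (x $ j) ^ (b $ j)) + a $ Inr 1"

definition variety ::
    "('d::finite \<Rightarrow> ('n::finite, 'a::comm_semiring_1) mpoly) \<Rightarrow> ('d \<Rightarrow> nat ^ 'n)
      \<Rightarrow> ('d \<Rightarrow> 'a ^ ('n + 1)) \<Rightarrow> ('a ^ ('n + 'd)) set" where
  "variety h b a =
     {x. \<forall>i. x $ Inr i =
           mpoly_eval (h i) (\<chi> j. x $ Inl j) + diag_poly_fun (b i) (a i) (\<chi> j. x $ Inl j)}"

definition incidences :: "'p set \<Rightarrow> 'p set set \<Rightarrow> nat" where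
  "incidences P \<V> = card {(p, V) \<in> P \<times> \<V>. p \<in> V}"

end

theory Submission
  imports Defs "HOL-Analysis.Convex"
begin

text \<open>
  Projecting a point to its first \<open>n\<close> coordinates splits the space into fibres of size \<open>q\<^sup>d\<close>, and
  every variety is a transversal of these fibres. Let \<open>F(p)\<close> be the number of varieties through
  \<open>p\<close> minus the mean \<open>|\<V>| / q\<^sup>d\<close>; the discrepancy is the sum of \<open>F\<close> over \<open>P\<close>. As \<open>F\<close> sums to zero
  on each fibre, the indicator of \<open>P\<close> may be replaced by its deviation from the fibre means, whose
  square sum is at most \<open>|P| (1 - 1/q\<^sup>d)\<close>. The square sum of \<open>F\<close> is controlled by the pairwise
  intersections: since \<open>t \<mapsto> t\<^sup>b\<close> is injective when \<open>b\<close> is coprime to \<open>q - 1\<close>, distinct varieties share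
  at most \<open>q^(n - 1)\<close> points. Cauchy-Schwarz then gives both bounds.
\<close>

section \<open>Power maps and diagonal equations over a finite field\<close>

text \<open>Multiplication by \<open>x\<close> permutes the nonzero elements, so their product
  absorbs a factor \<open>x\<close> for each of them and can be cancelled.\<close>

lemma finite_field_power_card_minus_1:
  fixes x :: "'a::{field,finite}"
  assumes "x \<noteq> 0"
  shows "x ^ (CARD('a) - 1) = 1"
proof -
  let ?U = "UNIV - {0::'a}"
  have "bij_betw ((*) x) ?U ?U"
    by (rule bij_betwI[where g = "\<lambda>y. y / x"]) (use assms in auto)
  then have "prod ((*) x) ?U = \<Prod>?U"
    using prod.reindex_bij_betw[of "(*) x" ?U ?U "\<lambda>y. y"] by simp
  then have "x ^ card ?U * \<Prod>?U = \<Prod>?U"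
    by (simp add: prod.distrib)
  moreover have "\<Prod>?U \<noteq> 0"
    by simp
  moreover have "card ?U = CARD('a) - 1"
    by (simp add: card_Diff_singleton)
  ultimately show ?thesis
    by (metis mult_cancel_right1)
qed

text \<open>Bezout yields \<open>u\<close> with \<open>b * u\<close> congruent to 1 modulo the order
  of the multiplicative group, so raising to the power \<open>u\<close> undoes the map on nonzero
  elements. Zero is the only element with \<open>b\<close>-th power zero.\<close>

lemma finite_field_inj_power:
  fixes b :: nat
  assumes "b > 0" and "gcd b (CARD('a) - 1) = 1"
  shows "inj (\<lambda>x::'a::{field,finite}. x ^ b)"
proof (rule injI)
  fix x y :: 'a
  assume eq: "x ^ b = y ^ b"
  obtain u v where uv: "b * u = (CARD('a) - 1) * v + 1"
    using bezout_nat[of b "CARD('a) - 1"] assms by auto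
  have inverse_power: "(z ^ b) ^ u = z" if "z \<noteq> 0" for z :: 'a
  proof -
    have "(z ^ b) ^ u = (z ^ (CARD('a) - 1)) ^ v * z"
      by (simp only: power_mult[symmetric] uv power_add power_one_right)
    then show ?thesis
      using finite_field_power_card_minus_1[OF that] by simp
  qed
  show "x = y"
  proof (cases "x = 0 \<or> y = 0")
    case True
    then show ?thesis
      using eq assms(1) by (metis power_eq_0_iff)
  next
    case False
    then show ?thesis
      using eq inverse_power by metis
  qed
qed

text \<open>If only the constant terms differ, there is no solution. Otherwise some coefficient of
  \<open>a - a'\<close> at \<open>Inl j\<close> is nonzero, and injectivity of the power map leaves
  at most one solution on each line parallel to axis \<open>j\<close>. The product form of the bound
  avoids the exponent \<open>CARD('n) - 1\<close>.\<close>

lemma card_diag_poly_fun_eq_le: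
  fixes a a' :: "'a::{field,finite} ^ ('n::finite + 1)"
  assumes pos: "\<And>j. b $ j > 0" and coprime: "\<And>j. gcd (b $ j) (CARD('a) - 1) = 1"
    and neq: "a \<noteq> a'"
  shows "card {x. diag_poly_fun b a x = diag_poly_fun b a' x} * CARD('a) \<le> CARD('a) ^ CARD('n)"
    (is "card ?S * _ \<le> _")
proof (cases "\<forall>j. a $ Inl j = a' $ Inl j")
  case True
  have "a $ Inr 1 \<noteq> a' $ Inr 1"
  proof
    assume "a $ Inr 1 = a' $ Inr 1"
    then have "a $ k = a' $ k" for k
      using True by (cases k) (simp, metis num1_eq1)
    with neq show False
      by (simp add: vec_eq_iff)
  qed
  then have "?S = {}"
    using True by (auto simp: diag_poly_fun_def)
  then show ?thesis
    by (metis card.empty mult_0 zero_le)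
next
  case False
  then obtain j where j: "a $ Inl j \<noteq> a' $ Inl j"
    by blast
  have coord: "x $ j = x' $ j"
    if x: "x \<in> ?S" and x': "x' \<in> ?S" and off: "\<And>i. i \<noteq> j \<Longrightarrow> x $ i = x' $ i" for x x'
  proof -
    define c where "c = a - a'"
    have split: "diag_poly_fun b a z - diag_poly_fun b a' z =
        c $ Inl j * (z $ j) ^ (b $ j)
          + ((\<Sum>i\<in>UNIV - {j}. c $ Inl i * (z $ i) ^ (b $ i)) + c $ Inr 1)" for z
    proof -
      have "diag_poly_fun b a z - diag_poly_fun b a' z =
          (\<Sum>i\<in>UNIV. c $ Inl i * (z $ i) ^ (b $ i)) + c $ Inr 1"
        by (simp add: diag_poly_fun_def c_def sum_subtractf left_diff_distrib)
      then show ?thesis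
        by (simp add: sum.remove[of UNIV j])
    qed
    have "(\<Sum>i\<in>UNIV - {j}. c $ Inl i * (x $ i) ^ (b $ i))
        = (\<Sum>i\<in>UNIV - {j}. c $ Inl i * (x' $ i) ^ (b $ i))"
      using off by (intro sum.cong) auto
    moreover have "diag_poly_fun b a x - diag_poly_fun b a' x
        = diag_poly_fun b a x' - diag_poly_fun b a' x'"
      using x x' by simp
    ultimately have "c $ Inl j * (x $ j) ^ (b $ j) = c $ Inl j * (x' $ j) ^ (b $ j)"
      unfolding split by simp
    then have "(x $ j) ^ (b $ j) = (x' $ j) ^ (b $ j)"
      using j by (simp add: c_def)
    then show ?thesis
      using finite_field_inj_power[OF pos coprime] by (auto dest: injD)
  qed
  \<comment> \<open>Translating along axis \<open>j\<close> gives \<open>CARD('a)\<close> copies of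
    the solution set; they are disjoint because each line in that direction meets it at most
    once.\<close>
  let ?shift = "\<lambda>(x :: 'a ^ 'n, t). \<chi> i. if i = j then x $ j + t else x $ i"
  have "inj_on ?shift (?S \<times> UNIV)"
  proof (rule inj_onI)
    fix z z'
    assume z: "z \<in> ?S \<times> UNIV" and z': "z' \<in> ?S \<times> UNIV" and "?shift z = ?shift z'"
    obtain x t x' t' where xt: "z = (x, t)" "z' = (x', t')"
      by (cases z, cases z') blast
    have eq: "(\<chi> i. if i = j then x $ j + t else x $ i)
        = (\<chi> i. if i = j then x' $ j + t' else x' $ i)"
      using \<open>?shift z = ?shift z'\<close> xt by simp
    have off: "x $ i = x' $ i" if "i \<noteq> j" for i
      using eq that by (auto simp: vec_eq_iff dest: spec[of _ i])
    moreover have "x $ j + t = x' $ j + t'"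
      using eq by (auto simp: vec_eq_iff dest: spec[of _ j])
    moreover have "x $ j = x' $ j"
      using z z' xt off by (intro coord) auto
    ultimately show "z = z'"
      unfolding xt by (simp add: vec_eq_iff) metis
  qed
  then have "card (?S \<times> (UNIV :: 'a set)) \<le> CARD('a ^ 'n)"
    by (rule card_inj_on_le) auto
  then show ?thesis
    by (simp add: card_cartesian_product)
qed

section \<open>Projection to the first coordinates and intersections of varieties\<close>

lemma card_fibre:
  "card {p :: 'a::finite ^ ('n::finite + 'd::finite). (\<chi> j. p $ Inl j) = x} = CARD('a) ^ CARD('d)"
proof -
  have "bij_betw (\<lambda>y::'a ^ 'd. \<chi> k. case k of Inl j \<Rightarrow> x $ j | Inr i \<Rightarrow> y $ i) UNIV
      {p :: 'a ^ ('n + 'd). (\<chi> j. p $ Inl j) = x}"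
    by (rule bij_betwI[where g = "\<lambda>p. \<chi> i. p $ Inr i"])
      (auto simp: vec_eq_iff split: sum.split)
  then show ?thesis
    using bij_betw_same_card by fastforce
qed

lemma variety_transversal:
  fixes h :: "'d::finite \<Rightarrow> ('n::finite, 'a::{field,finite}) mpoly"
  shows "\<exists>!p. p \<in> variety h b a \<and> (\<chi> j. p $ Inl j) = x"
proof (rule ex1I)
  let ?p = "\<chi> k. case k of Inl j \<Rightarrow> x $ j
    | Inr i \<Rightarrow> mpoly_eval (h i) x + diag_poly_fun (b i) (a i) x"
  show "?p \<in> variety h b a \<and> (\<chi> j. ?p $ Inl j) = x"
    by (simp add: variety_def)
  show "p = ?p" if "p \<in> variety h b a \<and> (\<chi> j. p $ Inl j) = x" for p
    using that by (auto simp: variety_def vec_eq_iff split: sum.split)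
qed

text \<open>Distinct varieties have \<open>a i \<noteq> a' i\<close> for some \<open>i\<close>. At a
  common point the two \<open>i\<close>-th equations share the left side and the \<open>h i\<close>
  term, so the diagonal polynomials agree there; the projection is injective on a variety, so no
  point is lost in counting.\<close>

lemma card_variety_Int_le:
  fixes h :: "'d::finite \<Rightarrow> ('n::finite, 'a::{field,finite}) mpoly"
  assumes pos: "\<And>i j. b i $ j > 0" and coprime: "\<And>i j. gcd (b i $ j) (CARD('a) - 1) = 1"
    and neq: "variety h b a \<noteq> variety h b a'"
  shows "card (variety h b a \<inter> variety h b a') * CARD('a) \<le> CARD('a) ^ CARD('n)"
proof -
  obtain i where i: "a i \<noteq> a' i"
    using neq by (metis ext)
  let ?I = "variety h b a \<inter> variety h b a'"
  let ?S = "{x. diag_poly_fun (b i) (a i) x = diag_poly_fun (b i) (a' i) x}"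
  have "inj_on (\<lambda>p. \<chi> j. p $ Inl j) ?I"
    using variety_transversal[of h b a] by (intro inj_onI) blast
  moreover have "(\<lambda>p. \<chi> j. p $ Inl j) ` ?I \<subseteq> ?S"
    by (auto simp: variety_def)
  ultimately have "card ?I \<le> card ?S"
    by (intro card_inj_on_le) auto
  then have "card ?I * CARD('a) \<le> card ?S * CARD('a)"
    by simp
  also have "\<dots> \<le> CARD('a) ^ CARD('n)"
    using card_diag_poly_fun_eq_le pos coprime i by blast
  finally show ?thesis .
qed

section \<open>Discrepancy of a family of transversals\<close>

lemma card_eq_sum_indicator: "finite A \<Longrightarrow> real (card {x \<in> A. Q x}) = (\<Sum>x\<in>A. of_bool (Q x))"
  by (simp add: of_bool_def sum.If_cases Int_def)

text \<open>Cauchy-Schwarz for two functions centred on the fibres: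
  \<open>real (card P) * (1 - 1 / r)\<close> bounds the square sum of the centred indicator of
  \<open>P\<close>, the remaining factor that of the centred incidence counts. A real
  \<open>k\<close> admits a quotient of powers as intersection bound.\<close>

lemma transversal_discrepancy:
  fixes \<pi> :: "'p::finite \<Rightarrow> 'x::finite" and P :: "'p set" and \<V> :: "'p set set" and r :: nat and k :: real
  assumes fibre: "\<And>x. card {p. \<pi> p = x} = r" and r: "r > 0"
    and transversal: "\<And>V x. V \<in> \<V> \<Longrightarrow> \<exists>!p. p \<in> V \<and> \<pi> p = x"
    and inter: "\<And>V W. V \<in> \<V> \<Longrightarrow> W \<in> \<V> \<Longrightarrow> V \<noteq> W \<Longrightarrow> card (V \<inter> W) \<le> k"
  shows "(real (incidences P \<V>) - real (card P) * real (card \<V>) / r)\<^sup>2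
    \<le> real (card P) * (1 - 1 / r)
      * (real (card \<V>) * (CARD('x) - k) + (real (card \<V>))\<^sup>2 * (k - CARD('x) / r))"
proof -
  define v where "v = real (card \<V>)"
  define N where "N p = (\<Sum>V\<in>\<V>. of_bool (p \<in> V) :: real)" for p
  define F where "F p = N p - v / r" for p
  \<comment> \<open>\<open>\<kappa> x\<close> counts the points of \<open>P\<close> over
    \<open>x\<close>, so \<open>G\<close> is the indicator of \<open>P\<close> minus its mean on the
    fibre.\<close>
  define \<kappa> where "\<kappa> x = (\<Sum>p | \<pi> p = x. of_bool (p \<in> P) :: real)" for x
  define G where "G p = of_bool (p \<in> P) - \<kappa> (\<pi> p) / r" for p
  have by_fibres: "(\<Sum>p\<in>UNIV. f p) = (\<Sum>x\<in>UNIV. \<Sum>p | \<pi> p = x. f p)" for f :: "'p \<Rightarrow> real"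
    using sum.group[of UNIV UNIV \<pi> f] by simp
  have fibre_V: "(\<Sum>p | \<pi> p = x. of_bool (p \<in> V) :: real) = 1" if "V \<in> \<V>" for V x
  proof -
    have "card {p \<in> {p. \<pi> p = x}. p \<in> V} = 1"
      using transversal[OF that, of x] by (auto simp: card_1_singleton_iff Ex1_def)
    then show ?thesis
      using card_eq_sum_indicator[of "{p. \<pi> p = x}" "\<lambda>p. p \<in> V"] by simp
  qed
  have fibre_N: "(\<Sum>p | \<pi> p = x. N p) = v" for x
    unfolding N_def by (subst sum.swap) (simp only: fibre_V sum_constant mult_1_right v_def cong: sum.cong)
  have fibre_F: "(\<Sum>p | \<pi> p = x. F p) = 0" for x
    using r by (simp add: F_def sum_subtractf fibre_N fibre)
  have sum_P: "(\<Sum>p\<in>UNIV. of_bool (p \<in> P) :: real) = card P"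
    using card_eq_sum_indicator[of UNIV "\<lambda>p. p \<in> P"] by simp
  have sum_\<kappa>: "(\<Sum>x\<in>UNIV. \<kappa> x) = card P"
    using by_fibres[of "\<lambda>p. of_bool (p \<in> P)"] by (simp add: sum_P \<kappa>_def)
  have incid: "real (incidences P \<V>) = (\<Sum>p\<in>P. N p)"
  proof -
    have "{(p, V) \<in> P \<times> \<V>. p \<in> V} = {z \<in> P \<times> \<V>. fst z \<in> snd z}"
      by auto
    then have "real (incidences P \<V>) = (\<Sum>z\<in>P \<times> \<V>. of_bool (fst z \<in> snd z))"
      unfolding incidences_def by (simp only: card_eq_sum_indicator[of "P \<times> \<V>"] finite)
    then show ?thesis
      by (simp only: N_def sum.cartesian_product case_prod_unfold)
  qed
  \<comment> \<open>The subtracted means are constant on fibres, where \<open>F\<close> sums to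
    zero, so pairing \<open>F\<close> with \<open>G\<close> still gives the discrepancy. Using
    \<open>G\<close> gains the factor \<open>1 - 1 / r\<close>.\<close>
  have "(\<Sum>p\<in>UNIV. F p * G p) = (\<Sum>p\<in>UNIV. F p * of_bool (p \<in> P)) - (\<Sum>p\<in>UNIV. F p * \<kappa> (\<pi> p) / r)"
    by (simp add: G_def right_diff_distrib sum_subtractf)
  also have "(\<Sum>p\<in>UNIV. F p * \<kappa> (\<pi> p) / r) = (\<Sum>x\<in>UNIV. (\<Sum>p | \<pi> p = x. F p) * \<kappa> x / r)"
    by (simp add: by_fibres sum_distrib_right sum_divide_distrib)
  also have "\<dots> = 0"
    by (simp add: fibre_F)
  also have "(\<Sum>p\<in>UNIV. F p * of_bool (p \<in> P)) = (\<Sum>p\<in>P. F p)"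
    by (simp add: of_bool_def if_distrib sum.If_cases cong: if_cong)
  also have "\<dots> = real (incidences P \<V>) - real (card P) * v / r"
    by (simp add: F_def sum_subtractf incid)
  finally have FG: "(\<Sum>p\<in>UNIV. F p * G p) = real (incidences P \<V>) - real (card P) * v / r"
    by simp
  have G2: "(\<Sum>p\<in>UNIV. (G p)\<^sup>2) \<le> real (card P) * (1 - 1 / r)"
  proof -
    have "(\<Sum>p | \<pi> p = x. (G p)\<^sup>2) = \<kappa> x - (\<kappa> x)\<^sup>2 / r" for x
    proof -
      have "(\<Sum>p | \<pi> p = x. (G p)\<^sup>2)
          = (\<Sum>p | \<pi> p = x. of_bool (p \<in> P) - 2 * (\<kappa> x / r) * of_bool (p \<in> P) + (\<kappa> x / r)\<^sup>2)"
        by (intro sum.cong) (auto simp: G_def power2_diff)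
      also have "\<dots> = \<kappa> x - 2 * (\<kappa> x / r) * \<kappa> x + r * (\<kappa> x / r)\<^sup>2"
        by (simp only: sum.distrib sum_subtractf sum_distrib_left[symmetric] \<kappa>_def[symmetric]
            sum_constant fibre)
      also have "\<dots> = \<kappa> x - (\<kappa> x)\<^sup>2 / r"
        using r by (simp add: field_simps power2_eq_square)
      finally show ?thesis .
    qed
    then have "(\<Sum>p\<in>UNIV. (G p)\<^sup>2) = (\<Sum>x\<in>UNIV. \<kappa> x - (\<kappa> x)\<^sup>2 / r)"
      by (simp add: by_fibres)
    also have "\<dots> \<le> (\<Sum>x\<in>UNIV. \<kappa> x * (1 - 1 / r))"
    proof (rule sum_mono)
      fix x
      have \<kappa>: "\<kappa> x = real (card {p \<in> {p. \<pi> p = x}. p \<in> P})"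
        by (simp only: card_eq_sum_indicator[OF finite] \<kappa>_def)
      \<comment> \<open>Integrality matters here: the inequality fails for reals strictly between 0
        and 1.\<close>
      have "\<kappa> x \<le> (\<kappa> x)\<^sup>2"
        unfolding \<kappa> power2_eq_square of_nat_mult[symmetric] of_nat_le_iff by (rule le_square)
      then show "\<kappa> x - (\<kappa> x)\<^sup>2 / r \<le> \<kappa> x * (1 - 1 / r)"
        using r by (simp add: field_simps)
    qed
    also have "\<dots> = real (card P) * (1 - 1 / r)"
      by (simp only: sum_distrib_right[symmetric] sum_\<kappa>)
    finally show ?thesis .
  qed
  have F2: "(\<Sum>p\<in>UNIV. (F p)\<^sup>2) \<le> v * (CARD('x) - k) + v\<^sup>2 * (k - CARD('x) / r)"
  proof -
    have card_V: "card V = CARD('x)" if "V \<in> \<V>" for V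
    proof -
      have "inj_on \<pi> V"
        using transversal[OF that] by (intro inj_onI) blast
      moreover have "x \<in> \<pi> ` V" for x
        using transversal[OF that, of x] by blast
      ultimately have "bij_betw \<pi> V UNIV"
        by (auto simp: bij_betw_def)
      then show ?thesis
        by (rule bij_betw_same_card)
    qed
    have sum_N: "(\<Sum>p\<in>UNIV. N p) = CARD('x) * v"
      by (simp add: by_fibres fibre_N)
    have card_UNIV: "real CARD('p) = real CARD('x) * real r"
      using by_fibres[of "\<lambda>_. 1"] by (simp add: fibre)
    have "(\<Sum>p\<in>UNIV. (N p)\<^sup>2) = (\<Sum>p\<in>UNIV. \<Sum>V\<in>\<V>. \<Sum>W\<in>\<V>. of_bool (p \<in> V \<inter> W))"
      by (simp only: N_def power2_eq_square sum_product of_bool_conj Int_iff)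
    also have "\<dots> = (\<Sum>V\<in>\<V>. \<Sum>W\<in>\<V>. \<Sum>p\<in>UNIV. of_bool (p \<in> V \<inter> W))"
      by (subst sum.swap, rule sum.cong[OF refl], rule sum.swap)
    also have "\<dots> = (\<Sum>V\<in>\<V>. \<Sum>W\<in>\<V>. real (card (V \<inter> W)))"
      by (intro sum.cong refl, subst card_eq_sum_indicator[symmetric]) (auto intro: arg_cong[of _ _ card])
    \<comment> \<open>The indicator term raises \<open>k\<close> to \<open>CARD('x)\<close> on the
      diagonal, where the intersection is a full transversal.\<close>
    also have "\<dots> \<le> (\<Sum>V\<in>\<V>. \<Sum>W\<in>\<V>. k + of_bool (W = V) * (CARD('x) - k))"
      by (intro sum_mono) (auto simp: card_V inter)
    also have "\<dots> = v * (v * k + (CARD('x) - k))"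
      by (simp add: sum.distrib sum_distrib_right[symmetric] v_def of_bool_def sum.delta)
    finally have N2: "(\<Sum>p\<in>UNIV. (N p)\<^sup>2) \<le> v * (v * k + (CARD('x) - k))" .
    have "(\<Sum>p\<in>UNIV. (F p)\<^sup>2) = (\<Sum>p\<in>UNIV. (N p)\<^sup>2 - 2 * (v / r) * N p + (v / r)\<^sup>2)"
      by (intro sum.cong) (simp_all add: F_def power2_diff)
    also have "\<dots> = (\<Sum>p\<in>UNIV. (N p)\<^sup>2) - 2 * (v / r) * (CARD('x) * v) + real CARD('x) * real r * (v / r)\<^sup>2"
      by (simp only: sum.distrib sum_subtractf sum_distrib_left[symmetric] sum_N sum_constant card_UNIV)
    also have "\<dots> = (\<Sum>p\<in>UNIV. (N p)\<^sup>2) - v\<^sup>2 * (CARD('x) / r)"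
      using r by (simp add: field_simps power2_eq_square)
    finally show ?thesis
      using N2 by (simp add: algebra_simps power2_eq_square)
  qed
  have "(\<Sum>p\<in>UNIV. F p * G p)\<^sup>2 \<le> (\<Sum>p\<in>UNIV. (F p)\<^sup>2) * (\<Sum>p\<in>UNIV. (G p)\<^sup>2)"
    by (rule Cauchy_Schwarz_ineq_sum)
  also have "\<dots> \<le> (v * (CARD('x) - k) + v\<^sup>2 * (k - CARD('x) / r)) * (real (card P) * (1 - 1 / r))"
    \<comment> \<open>Nonnegativity of the bound on the square sum of \<open>F\<close> is read off
      from \<open>F2\<close> itself, as its formula does not show it for arbitrary
      \<open>k\<close>.\<close>
    using F2 G2 by (intro mult_mono) (auto intro: sum_nonneg order_trans[OF sum_nonneg F2])
  finally show ?thesis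
    by (simp only: FG v_def mult_ac)
qed

section \<open>Incidence bounds for the two ranges of \<open>d\<close>\<close>

theorem theorem1p4:
  fixes h :: "'d::finite \<Rightarrow> ('n::finite, 'a::{field,finite}) mpoly"
    and b :: "'d \<Rightarrow> nat ^ 'n"
    and P :: "('a ^ ('n + 'd)) set"
    and \<V> :: "('a ^ ('n + 'd)) set set"
    and q n d :: nat
  assumes q: "q = CARD('a)" and n: "n = CARD('n)" and d: "d = CARD('d)"
    and h_degree: "\<And>i. total_degree (h i) \<le> q - 1"
    and b_pos: "\<And>i j. b i $ j > 0"
    and b_gcd: "\<And>i j. gcd (b i $ j) (q - 1) = 1"
    and varieties: "\<V> \<subseteq> {variety h b a | a. True}"
  shows "(d \<ge> 2 \<longrightarrow>
            \<bar>real (incidences P \<V>) - real (card P) * real (card \<V>) / real q ^ d\<bar>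
              \<le> real q powr (real n / 2) * sqrt (real (card P) * real (card \<V>))
                  * (1 + real (card \<V>) / real q) powr (1 / 2)) \<and>
         (d = 1 \<longrightarrow>
            \<bar>real (incidences P \<V>) - real (card P) * real (card \<V>) / real q\<bar>
              \<le> real q powr (real n / 2) * (1 - 1 / real q)
                  * sqrt (real (card P) * real (card \<V>)))"
proof -
  have q0: "q > 0"
    by (simp add: q)
  define p v where "p = real (card P)" and "v = real (card \<V>)"
  have nonneg: "p \<ge> 0" "v \<ge> 0"
    by (simp_all add: p_def v_def)
  let ?D = "real (incidences P \<V>) - p * v / real q ^ d"
  \<comment> \<open>The fibre size is \<open>r = q ^ d\<close>, the base has \<open>q ^ n\<close>
    points, and \<open>k = q ^ n / q\<close>.\<close>
  have "(real (incidences P \<V>) - real (card P) * real (card \<V>) / real (q ^ d))\<^sup>2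
      \<le> real (card P) * (1 - 1 / real (q ^ d))
        * (real (card \<V>) * (real CARD('a ^ 'n) - real q ^ n / q)
          + (real (card \<V>))\<^sup>2 * (real q ^ n / q - CARD('a ^ 'n) / real (q ^ d)))"
  proof (rule transversal_discrepancy)
    show "card {p :: 'a ^ ('n + 'd). (\<chi> j. p $ Inl j) = x} = q ^ d" for x :: "'a ^ 'n"
      by (simp add: card_fibre q d)
    show "0 < q ^ d"
      using q0 by simp
    show "\<exists>!p. p \<in> V \<and> (\<chi> j. p $ Inl j) = x" if "V \<in> \<V>" for V and x :: "'a ^ 'n"
      using that varieties variety_transversal[of h b _ x] by blast
    show "real (card (V \<inter> W)) \<le> real q ^ n / q" if "V \<in> \<V>" "W \<in> \<V>" "V \<noteq> W" for V W
    proof -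
      obtain a a' where "V = variety h b a" "W = variety h b a'"
        using varieties \<open>V \<in> \<V>\<close> \<open>W \<in> \<V>\<close> by blast
      then have "card (V \<inter> W) * q \<le> q ^ n"
        using card_variety_Int_le[of b h a a'] b_pos b_gcd that(3) by (simp add: q n)
      then have "real (card (V \<inter> W)) * real q \<le> real q ^ n"
        by (metis of_nat_le_iff of_nat_mult of_nat_power)
      then show ?thesis
        using q0 by (simp add: field_simps)
    qed
  qed
  then have bound: "?D\<^sup>2 \<le> p * (1 - 1 / real q ^ d)
      * (v * (real q ^ n - real q ^ n / q) + v\<^sup>2 * (real q ^ n / q - real q ^ n / real q ^ d))"
    by (simp add: p_def v_def q n)
  have sqrt_q: "real q powr (real n / 2) = sqrt (real q ^ n)"
    using q0 by (simp add: powr_half_sqrt[symmetric] powr_realpow[symmetric] powr_powr)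
  show ?thesis
    unfolding p_def[symmetric] v_def[symmetric]
  proof (intro conjI impI)
    assume "d \<ge> 2"
    \<comment> \<open>This keeps \<open>q ^ n / q - q ^ n / q ^ d\<close> nonnegative, as needed to
      multiply the estimates once the negative terms are dropped.\<close>
    then have "q \<le> q ^ d"
      using q0 by (simp add: self_le_power)
    have "?D\<^sup>2 \<le> p * 1 * (v * real q ^ n + v\<^sup>2 * (real q ^ n / q))"
      using q0 nonneg \<open>q \<le> q ^ d\<close>
      by (intro order_trans[OF bound] mult_mono add_mono mult_left_mono mult_nonneg_nonneg
          add_nonneg_nonneg) (auto simp: field_simps)
    also have "\<dots> = real q ^ n * (p * v) * (1 + v / q)"
      using q0 by (simp add: field_simps power2_eq_square)
    finally have "\<bar>?D\<bar> \<le> sqrt (real q ^ n * (p * v) * (1 + v / q))"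
      using real_le_rsqrt[of "\<bar>?D\<bar>"] by simp
    then show "\<bar>?D\<bar> \<le> real q powr (real n / 2) * sqrt (p * v) * (1 + v / real q) powr (1 / 2)"
      using nonneg by (simp add: sqrt_q real_sqrt_mult powr_half_sqrt)
  next
    assume d1: "d = 1"
    \<comment> \<open>For \<open>d = 1\<close> the coefficient of \<open>v\<^sup>2\<close> vanishes,
      and the two factors \<open>1 - 1 / q\<close>, one from \<open>P\<close> and one from the
      intersections, form a square that leaves the root intact.\<close>
    have "?D\<^sup>2 \<le> real q ^ n * (1 - 1 / real q)\<^sup>2 * (p * v)"
    proof -
      have "p * (1 - 1 / real q) * (v * (real q ^ n - real q ^ n / q))
          = real q ^ n * (1 - 1 / real q)\<^sup>2 * (p * v)"
        using q0 by (simp add: field_simps power2_eq_square)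
      then show ?thesis
        using bound by (simp only: d1 power_one_right diff_self mult_zero_right add_0_right)
    qed
    then have "\<bar>?D\<bar> \<le> sqrt (real q ^ n * (1 - 1 / real q)\<^sup>2 * (p * v))"
      using real_le_rsqrt[of "\<bar>?D\<bar>"] by simp
    moreover have "1 - 1 / real q \<ge> 0"
      using q0 by simp
    ultimately show "\<bar>real (incidences P \<V>) - p * v / real q\<bar>
        \<le> real q powr (real n / 2) * (1 - 1 / real q) * sqrt (p * v)"
      by (simp add: sqrt_q real_sqrt_mult d1)
  qed
qed

end
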